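(* Let $\mu$ and $k$ be positive integers. If the maximum number of mutually orthogonal Latin squares of order $k+1$ is greater than or equal to $\mu+1$, then there exists a $(\mu,k,k+1)$ Latin trade.
   Context: A partial Latin square is a square array, some of whose cells are filled with symbols from a finite set and the others empty, such that each symbol occurs at most once in each row and at most once in each column. For a positive integer $\mu$, a $\mu$-way Latin trade is a tuple $(T_1,\dots,T_\mu)$ of partial Latin squares with exactly the same set of filled cells such that: every filled cell $(i,j)$ contains pairwise different entries in $T_1,\dots,T_\mu$; for each row $i$, the set of symbols in row $i$ is the same in all of $T_1,\dots,T_\mu$; and for each column $j$, the set of symbols in column $j$ is the same in all of $T_1,\dots,T_\mu$. For $\mu\le k\le m$, a $(\mu,k,m)$ Latin trade (also called a $\mu$-way $k$-homogeneous Latin trade) is a $\mu$-way Latin trade $(T_1,\dots,T_\mu)$ consisting of $m\times m$ arrays on a set of $m$ symbols such that in each $T_r$ every row has exactly $k$ filled cells, every column has exactly $k$ filled cells, and every symbol appears exactly $k$ times. *)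

theory Defs
  imports Main
begin

text \<open>
  An \<open>m\<times>m\<close> array has its rows and columns indexed by \<open>{..<m}\<close>; values outside this
  range are irrelevant. In a partial array the value \<open>None\<close> stands for an empty cell.
\<close>

definition latin_square :: "nat \<Rightarrow> (nat \<Rightarrow> nat \<Rightarrow> nat) \<Rightarrow> bool" where
  "latin_square n L \<longleftrightarrow>
     (\<forall>i<n. bij_betw (\<lambda>j. L i j) {..<n} {..<n}) \<and>
     (\<forall>j<n. bij_betw (\<lambda>i. L i j) {..<n} {..<n})"

definition orthogonal_squares :: "nat \<Rightarrow> (nat \<Rightarrow> nat \<Rightarrow> nat) \<Rightarrow> (nat \<Rightarrow> nat \<Rightarrow> nat) \<Rightarrow> bool" where
  "orthogonal_squares n A B \<longleftrightarrow>
     bij_betw (\<lambda>(i, j). (A i j, B i j)) ({..<n} \<times> {..<n}) ({..<n} \<times> {..<n})"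

definition mutually_orthogonal_latin_squares ::
    "nat \<Rightarrow> nat \<Rightarrow> (nat \<Rightarrow> nat \<Rightarrow> nat \<Rightarrow> nat) \<Rightarrow> bool" where
  "mutually_orthogonal_latin_squares n t L \<longleftrightarrow>
     (\<forall>a<t. latin_square n (L a)) \<and>
     (\<forall>a<t. \<forall>b<t. a \<noteq> b \<longrightarrow> orthogonal_squares n (L a) (L b))"

text \<open>
  For \<open>n \<ge> 2\<close> orthogonal Latin squares are distinct, so the set below is finite, and it
  contains \<open>0\<close>. For \<open>n \<le> 1\<close> the set is infinite and the value is unspecified.
\<close>

definition max_mols :: "nat \<Rightarrow> nat" where
  "max_mols n = Max {t. \<exists>L. mutually_orthogonal_latin_squares n t L}"

definition partial_latin_square :: "nat \<Rightarrow> 's set \<Rightarrow> (nat \<Rightarrow> nat \<Rightarrow> 's option) \<Rightarrow> bool" where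
  "partial_latin_square m S T \<longleftrightarrow>
     finite S \<and>
     (\<forall>i<m. \<forall>j<m. \<forall>s. T i j = Some s \<longrightarrow> s \<in> S) \<and>
     (\<forall>i<m. \<forall>j<m. \<forall>j'<m. \<forall>s. T i j = Some s \<and> T i j' = Some s \<longrightarrow> j = j') \<and>
     (\<forall>j<m. \<forall>i<m. \<forall>i'<m. \<forall>s. T i j = Some s \<and> T i' j = Some s \<longrightarrow> i = i')"

definition row_symbols :: "nat \<Rightarrow> (nat \<Rightarrow> nat \<Rightarrow> 's option) \<Rightarrow> nat \<Rightarrow> 's set" where
  "row_symbols m T i = {s. \<exists>j<m. T i j = Some s}"

definition col_symbols :: "nat \<Rightarrow> (nat \<Rightarrow> nat \<Rightarrow> 's option) \<Rightarrow> nat \<Rightarrow> 's set" where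
  "col_symbols m T j = {s. \<exists>i<m. T i j = Some s}"

text \<open>The tuple \<open>(T\<^sub>1, \<dots>, T\<^sub>\<mu>)\<close> is the family \<open>T 0, \<dots>, T (\<mu> - 1)\<close>.\<close>

definition way_latin_trade ::
    "nat \<Rightarrow> nat \<Rightarrow> 's set \<Rightarrow> (nat \<Rightarrow> nat \<Rightarrow> nat \<Rightarrow> 's option) \<Rightarrow> bool" where
  "way_latin_trade \<mu> m S T \<longleftrightarrow>
     0 < \<mu> \<and>
     (\<forall>r<\<mu>. partial_latin_square m S (T r)) \<and>
     (\<forall>r<\<mu>. \<forall>r'<\<mu>. \<forall>i<m. \<forall>j<m. T r i j = None \<longleftrightarrow> T r' i j = None) \<and>
     (\<forall>r<\<mu>. \<forall>r'<\<mu>. \<forall>i<m. \<forall>j<m. r \<noteq> r' \<and> T r i j \<noteq> None \<longrightarrow> T r i j \<noteq> T r' i j) \<and>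
     (\<forall>r<\<mu>. \<forall>r'<\<mu>. \<forall>i<m. row_symbols m (T r) i = row_symbols m (T r') i) \<and>
     (\<forall>r<\<mu>. \<forall>r'<\<mu>. \<forall>j<m. col_symbols m (T r) j = col_symbols m (T r') j)"

definition homogeneous_latin_trade ::
    "nat \<Rightarrow> nat \<Rightarrow> nat \<Rightarrow> 's set \<Rightarrow> (nat \<Rightarrow> nat \<Rightarrow> nat \<Rightarrow> 's option) \<Rightarrow> bool" where
  "homogeneous_latin_trade \<mu> k m S T \<longleftrightarrow>
     \<mu> \<le> k \<and> k \<le> m \<and> card S = m \<and>
     way_latin_trade \<mu> m S T \<and>
     (\<forall>r<\<mu>. \<forall>i<m. card {j. j < m \<and> T r i j \<noteq> None} = k) \<and>
     (\<forall>r<\<mu>. \<forall>j<m. card {i. i < m \<and> T r i j \<noteq> None} = k) \<and>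
     (\<forall>r<\<mu>. \<forall>s\<in>S. card {(i, j). i < m \<and> j < m \<and> T r i j = Some s} = k)"

end

theory Submission
  imports Defs
begin

text \<open>
  Let \<open>L 0, \<dots>, L \<mu>\<close> be mutually orthogonal Latin squares of order \<open>n = k + 1\<close>. The \<open>n\<close> cells
  in which the last square \<open>L \<mu>\<close> has the symbol \<open>0\<close> form a transversal \<open>{(i, \<sigma> i)}\<close>: they meet
  each row and column once and, by orthogonality, carry every symbol exactly once in each other
  square \<open>L r\<close>. The symbols of each \<open>L r\<close> can thus be renamed so that the cell \<open>(i, \<sigma> i)\<close>
  contains \<open>i\<close>; renaming preserves orthogonality.

  After this normalisation two squares agree exactly on the transversal: the agreements there
  already realise every pair \<open>(s, s)\<close>, and orthogonality allows each pair only once. Emptying the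
  transversal therefore leaves arrays that differ in every filled cell. They have the same row
  and column symbols, because from row \<open>i\<close> and from column \<open>\<sigma> i\<close> exactly the symbol \<open>i\<close> has been
  deleted in all of them, and every row, column and symbol has lost exactly one cell. A filled
  cell of row \<open>0\<close> holds \<open>\<mu>\<close> different symbols other than \<open>0\<close>, whence \<open>\<mu> \<le> k\<close>.

  This last inequality bounds the size of every family of orthogonal squares of order \<open>n \<ge> 2\<close>.
  Consequently \<open>max_mols n\<close> is the maximum of a finite set and is attained, which is
  what provides the \<open>\<mu> + 1\<close> squares.
\<close>

section \<open>Latin squares and renaming of symbols\<close>

lemma latin_square_less:
  assumes "latin_square n L" "i < n" "j < n"
  shows "L i j < n"
  using assms unfolding latin_square_def bij_betw_def by blast

lemma latin_square_row_inj:
  assumes "latin_square n L" "i < n" "j < n" "j' < n" "L i j = L i j'"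
  shows "j = j'"
  using assms unfolding latin_square_def bij_betw_def inj_on_def by blast

lemma latin_square_col_inj:
  assumes "latin_square n L" "j < n" "i < n" "i' < n" "L i j = L i' j"
  shows "i = i'"
  using assms unfolding latin_square_def bij_betw_def inj_on_def by blast

lemma latin_square_row_ex:
  assumes "latin_square n L" "i < n" "s < n"
  shows "\<exists>j<n. L i j = s"
proof -
  have "(\<lambda>j. L i j) ` {..<n} = {..<n}"
    using assms unfolding latin_square_def bij_betw_def by blast
  with \<open>s < n\<close> have "s \<in> (\<lambda>j. L i j) ` {..<n}" by simp
  then show ?thesis by auto
qed

lemma latin_square_col_ex:
  assumes "latin_square n L" "j < n" "s < n"
  shows "\<exists>i<n. L i j = s"
proof -
  have "(\<lambda>i. L i j) ` {..<n} = {..<n}"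
    using assms unfolding latin_square_def bij_betw_def by blast
  with \<open>s < n\<close> have "s \<in> (\<lambda>i. L i j) ` {..<n}" by simp
  then show ?thesis by auto
qed

lemma orthogonal_squares_cell_unique:
  assumes "orthogonal_squares n A B" "i < n" "j < n" "i' < n" "j' < n"
    and "A i j = A i' j'" "B i j = B i' j'"
  shows "i = i'" "j = j'"
proof -
  have "inj_on (\<lambda>(i, j). (A i j, B i j)) ({..<n} \<times> {..<n})"
    using assms(1) unfolding orthogonal_squares_def bij_betw_def by blast
  from inj_onD[OF this, of "(i, j)" "(i', j')"] assms(2-)
  show "i = i'" "j = j'" by auto
qed

lemma latin_square_relabel:
  assumes "latin_square n L" and "bij_betw p {..<n} {..<n}"
  shows "latin_square n (\<lambda>i j. p (L i j))"
  using assms bij_betw_trans[where g = p]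
  unfolding latin_square_def comp_def by blast

lemma orthogonal_squares_relabel:
  assumes "orthogonal_squares n A B"
    and p: "bij_betw p {..<n} {..<n}" and q: "bij_betw q {..<n} {..<n}"
  shows "orthogonal_squares n (\<lambda>i j. p (A i j)) (\<lambda>i j. q (B i j))"
proof -
  have "bij_betw (map_prod p q) ({..<n} \<times> {..<n}) ({..<n} \<times> {..<n})"
    using p q unfolding bij_betw_def by (simp add: map_prod_inj_on map_prod_surj_on)
  with assms(1) have
    "bij_betw (map_prod p q \<circ> (\<lambda>(i, j). (A i j, B i j))) ({..<n} \<times> {..<n}) ({..<n} \<times> {..<n})"
    unfolding orthogonal_squares_def by (rule bij_betw_trans)
  also have "map_prod p q \<circ> (\<lambda>(i, j). (A i j, B i j)) = (\<lambda>(i, j). (p (A i j), q (B i j)))"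
    by auto
  finally show ?thesis unfolding orthogonal_squares_def .
qed

section \<open>Transversals from orthogonal squares\<close>

lemma latin_square_symbol_permutation:
  assumes A: "latin_square n A" and "s < n"
  obtains \<sigma> where "bij_betw \<sigma> {..<n} {..<n}" "\<And>i. i < n \<Longrightarrow> A i (\<sigma> i) = s"
proof -
  have "\<forall>i. \<exists>j. i < n \<longrightarrow> j < n \<and> A i j = s"
    using latin_square_row_ex[OF A _ \<open>s < n\<close>] by blast
  then obtain \<sigma> where \<sigma>: "\<And>i. i < n \<Longrightarrow> \<sigma> i < n \<and> A i (\<sigma> i) = s" by metis
  have "inj_on \<sigma> {..<n}"
    by (rule inj_onI) (metis \<sigma> latin_square_col_inj[OF A] lessThan_iff)
  moreover have "\<sigma> ` {..<n} \<subseteq> {..<n}" using \<sigma> by auto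
  ultimately have "bij_betw \<sigma> {..<n} {..<n}"
    by (simp add: bij_betw_def endo_inj_surj)
  with \<sigma> show thesis by (auto intro: that)
qed

text \<open>
  The transversal carries every symbol of \<open>A\<close> once, because each symbol of \<open>A\<close> meets the
  symbol \<open>s\<close> of \<open>B\<close> in only one cell.
\<close>

lemma orthogonal_transversal_symbols:
  assumes A: "latin_square n A" and orth: "orthogonal_squares n A B"
    and \<sigma>: "bij_betw \<sigma> {..<n} {..<n}" and B: "\<And>i. i < n \<Longrightarrow> B i (\<sigma> i) = s"
  shows "bij_betw (\<lambda>i. A i (\<sigma> i)) {..<n} {..<n}"
proof -
  have \<sigma>_less: "\<sigma> i < n" if "i < n" for i
    using \<sigma> that unfolding bij_betw_def by blast
  have "inj_on (\<lambda>i. A i (\<sigma> i)) {..<n}"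
  proof (rule inj_onI)
    fix i i' assume "i \<in> {..<n}" "i' \<in> {..<n}" "A i (\<sigma> i) = A i' (\<sigma> i')"
    then show "i = i'"
      using orthogonal_squares_cell_unique(1)[OF orth, of i "\<sigma> i" i' "\<sigma> i'"] \<sigma>_less B by simp
  qed
  moreover have "(\<lambda>i. A i (\<sigma> i)) ` {..<n} \<subseteq> {..<n}"
    using latin_square_less[OF A] \<sigma>_less by auto
  ultimately show ?thesis by (simp add: bij_betw_def endo_inj_surj)
qed

text \<open>
  Whatever common value \<open>s\<close> the two squares might share outside the transversal, the pair
  \<open>(s, s)\<close> already occurs in the transversal cell of row \<open>s\<close>.
\<close>

lemma orthogonal_differ_off_transversal:
  assumes A: "latin_square n A" and orth: "orthogonal_squares n A B"
    and \<sigma>: "bij_betw \<sigma> {..<n} {..<n}"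
    and diag: "\<And>i. i < n \<Longrightarrow> A i (\<sigma> i) = i" "\<And>i. i < n \<Longrightarrow> B i (\<sigma> i) = i"
    and "i < n" "j < n" "j \<noteq> \<sigma> i"
  shows "A i j \<noteq> B i j"
proof
  assume eq: "A i j = B i j"
  define s where "s = A i j"
  have s: "s < n" using latin_square_less[OF A] assms unfolding s_def by blast
  then have "\<sigma> s < n" using \<sigma> unfolding bij_betw_def by blast
  moreover have "A i j = A s (\<sigma> s)" "B i j = B s (\<sigma> s)"
    using diag[OF s] eq s_def by simp_all
  ultimately have "i = s" "j = \<sigma> s"
    using orthogonal_squares_cell_unique[OF orth \<open>i < n\<close> \<open>j < n\<close> s] by blast+
  with \<open>j \<noteq> \<sigma> i\<close> show False by simp
qed

section \<open>Emptying a transversal\<close>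

definition puncture :: "(nat \<Rightarrow> nat) \<Rightarrow> (nat \<Rightarrow> nat \<Rightarrow> 's) \<Rightarrow> nat \<Rightarrow> nat \<Rightarrow> 's option" where
  "puncture \<sigma> M i j = (if j = \<sigma> i then None else Some (M i j))"

lemma puncture_eq_Some: "puncture \<sigma> M i j = Some s \<longleftrightarrow> j \<noteq> \<sigma> i \<and> M i j = s"
  by (simp add: puncture_def)

lemma puncture_eq_None: "puncture \<sigma> M i j = None \<longleftrightarrow> j = \<sigma> i"
  by (simp add: puncture_def)

context
  fixes n :: nat and M :: "nat \<Rightarrow> nat \<Rightarrow> nat" and \<sigma> :: "nat \<Rightarrow> nat"
  assumes M: "latin_square n M" and \<sigma>: "bij_betw \<sigma> {..<n} {..<n}"
    and diag: "\<And>i. i < n \<Longrightarrow> M i (\<sigma> i) = i"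
begin

lemma sigma_less: "i < n \<Longrightarrow> \<sigma> i < n"
  using \<sigma> unfolding bij_betw_def by blast

lemma partial_latin_square_puncture: "partial_latin_square n {..<n} (puncture \<sigma> M)"
  unfolding partial_latin_square_def puncture_eq_Some
  by (auto intro: latin_square_less[OF M]
    dest: latin_square_row_inj[OF M] latin_square_col_inj[OF M])

lemma row_symbols_puncture:
  assumes "i < n"
  shows "row_symbols n (puncture \<sigma> M) i = {..<n} - {i}"
proof (intro equalityI subsetI)
  fix s assume "s \<in> row_symbols n (puncture \<sigma> M) i"
  then obtain j where "j < n" "j \<noteq> \<sigma> i" "M i j = s"
    unfolding row_symbols_def puncture_eq_Some by auto
  then show "s \<in> {..<n} - {i}"
    using latin_square_less[OF M assms] latin_square_row_inj[OF M assms _ sigma_less[OF assms]]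
      diag[OF assms] by auto
next
  fix s assume "s \<in> {..<n} - {i}"
  then show "s \<in> row_symbols n (puncture \<sigma> M) i"
    using latin_square_row_ex[OF M assms, of s] diag assms
    unfolding row_symbols_def puncture_eq_Some by auto
qed

lemma col_symbols_puncture:
  assumes "i < n"
  shows "col_symbols n (puncture \<sigma> M) (\<sigma> i) = {..<n} - {i}"
proof (intro equalityI subsetI)
  fix s assume "s \<in> col_symbols n (puncture \<sigma> M) (\<sigma> i)"
  then obtain i' where "i' < n" "\<sigma> i \<noteq> \<sigma> i'" "M i' (\<sigma> i) = s"
    unfolding col_symbols_def puncture_eq_Some by auto
  then show "s \<in> {..<n} - {i}"
    using latin_square_less[OF M _ sigma_less[OF assms]]
      latin_square_col_inj[OF M sigma_less[OF assms] _ assms] diag[OF assms] by auto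
next
  fix s assume s: "s \<in> {..<n} - {i}"
  then obtain i' where i': "i' < n" "M i' (\<sigma> i) = s"
    using latin_square_col_ex[OF M sigma_less[OF assms], of s] by auto
  moreover have "\<sigma> i \<noteq> \<sigma> i'"
    using i' s \<sigma> diag assms unfolding bij_betw_def inj_on_def by auto
  ultimately show "s \<in> col_symbols n (puncture \<sigma> M) (\<sigma> i)"
    unfolding col_symbols_def puncture_eq_Some by auto
qed

lemma card_row_puncture:
  assumes "i < n"
  shows "card {j. j < n \<and> puncture \<sigma> M i j \<noteq> None} = n - 1"
proof -
  have "{j. j < n \<and> puncture \<sigma> M i j \<noteq> None} = {..<n} - {\<sigma> i}"
    by (auto simp: puncture_eq_None)
  then show ?thesis using sigma_less[OF assms] by simp
qed

lemma card_col_puncture: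
  assumes "i < n"
  shows "card {i'. i' < n \<and> puncture \<sigma> M i' (\<sigma> i) \<noteq> None} = n - 1"
proof -
  have "{i'. i' < n \<and> puncture \<sigma> M i' (\<sigma> i) \<noteq> None} = {..<n} - {i}"
    using \<sigma> assms unfolding bij_betw_def inj_on_def puncture_eq_None by auto
  then show ?thesis using assms by simp
qed

text \<open>A symbol \<open>s\<close> keeps exactly one cell in every row except row \<open>s\<close>.\<close>

lemma card_symbol_puncture:
  assumes "s < n"
  shows "card {(i, j). i < n \<and> j < n \<and> puncture \<sigma> M i j = Some s} = n - 1"
    (is "card ?C = _")
proof -
  have "inj_on fst ?C"
    by (rule inj_onI)
      (auto simp: puncture_eq_Some dest: latin_square_row_inj[OF M])
  moreover have "fst ` ?C = {..<n} - {s}"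
  proof (intro equalityI subsetI)
    fix i assume "i \<in> fst ` ?C"
    then obtain j where j: "i < n" "j < n" "puncture \<sigma> M i j = Some s" by auto
    then have "s \<in> row_symbols n (puncture \<sigma> M) i" unfolding row_symbols_def by auto
    with j row_symbols_puncture show "i \<in> {..<n} - {s}" by auto
  next
    fix i assume i: "i \<in> {..<n} - {s}"
    then have "s \<in> row_symbols n (puncture \<sigma> M) i"
      using row_symbols_puncture[of i] assms by auto
    then show "i \<in> fst ` ?C"
      using i unfolding row_symbols_def by force
  qed
  ultimately have "card ?C = card ({..<n} - {s})"
    using card_image[of fst ?C] by simp
  then show ?thesis using assms by simp
qed

end

section \<open>Homogeneous trades from orthogonal squares\<close>

text \<open>
  The symbols remaining in a row or column depend only on \<open>\<sigma>\<close>, by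
  the normalisation \<open>M r i (\<sigma> i) = i\<close>; this is what makes the punctured squares a trade.
\<close>

lemma homogeneous_latin_trade_puncture:
  fixes M :: "nat \<Rightarrow> nat \<Rightarrow> nat \<Rightarrow> nat"
  assumes pos: "0 < \<mu>" "0 < k" and n: "n = k + 1"
    and M: "\<And>r. r < \<mu> \<Longrightarrow> latin_square n (M r)"
    and \<sigma>: "bij_betw \<sigma> {..<n} {..<n}"
    and diag: "\<And>r i. r < \<mu> \<Longrightarrow> i < n \<Longrightarrow> M r i (\<sigma> i) = i"
    and differ: "\<And>r r' i j. r < \<mu> \<Longrightarrow> r' < \<mu> \<Longrightarrow> r \<noteq> r' \<Longrightarrow> i < n \<Longrightarrow> j < n \<Longrightarrow>
      j \<noteq> \<sigma> i \<Longrightarrow> M r i j \<noteq> M r' i j"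
  shows "homogeneous_latin_trade \<mu> k n {..<n} (\<lambda>r. puncture \<sigma> (M r))"
proof -
  note punct = M \<sigma> diag
  have col: "\<exists>i<n. j = \<sigma> i" if "j < n" for j
    using \<sigma> that unfolding bij_betw_def by (metis imageE lessThan_iff)
  have "\<mu> \<le> k"
  proof -
    \<comment> \<open>\<open>0 < k\<close> leaves a filled cell in row \<open>0\<close>; its \<open>\<mu>\<close> entries are distinct and nonzero\<close>
    obtain j where j: "j < n" "j \<noteq> \<sigma> 0"
      using n \<open>0 < k\<close> that[of 0] that[of 1] by (cases "\<sigma> 0 = 0") auto
    have "M r 0 j \<in> {..<n} - {0}" if "r < \<mu>" for r
    proof -
      have "M r 0 j \<in> row_symbols n (puncture \<sigma> (M r)) 0"
        using j unfolding row_symbols_def puncture_eq_Some by auto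
      then show ?thesis
        using row_symbols_puncture[OF punct, of r 0] that n by simp
    qed
    then have "(\<lambda>r. M r 0 j) ` {..<\<mu>} \<subseteq> {..<n} - {0}"
      by (intro image_subsetI) simp
    moreover have "inj_on (\<lambda>r. M r 0 j) {..<\<mu>}"
      using differ[where i = 0 and j = j] j n by (auto intro!: inj_onI)
    ultimately have "card {..<\<mu>} \<le> card ({..<n} - {0})"
      by (metis card_inj_on_le finite_Diff finite_lessThan)
    then show ?thesis using n by simp
  qed
  moreover have "way_latin_trade \<mu> n {..<n} (\<lambda>r. puncture \<sigma> (M r))"
    unfolding way_latin_trade_def
  proof (intro conjI allI impI)
    fix r r' j assume "r < \<mu>" "r' < \<mu>" "j < n"
    with col obtain i where "i < n" "j = \<sigma> i" by blast
    with \<open>r < \<mu>\<close> \<open>r' < \<mu>\<close>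
    show "col_symbols n (puncture \<sigma> (M r)) j = col_symbols n (puncture \<sigma> (M r')) j"
      by (simp add: col_symbols_puncture[OF punct])
  next
    fix r r' i j
    assume "r < \<mu>" "r' < \<mu>" "i < n" "j < n" "r \<noteq> r' \<and> puncture \<sigma> (M r) i j \<noteq> None"
    then show "puncture \<sigma> (M r) i j \<noteq> puncture \<sigma> (M r') i j"
      using differ by (auto simp: puncture_def)
  qed (use pos in \<open>simp_all add: partial_latin_square_puncture[OF punct]
         row_symbols_puncture[OF punct] puncture_eq_None\<close>)
  moreover have "card {i. i < n \<and> puncture \<sigma> (M r) i j \<noteq> None} = k" if "r < \<mu>" "j < n" for r j
    using col[OF \<open>j < n\<close>] card_col_puncture[OF punct] that n by auto
  ultimately show ?thesis
    unfolding homogeneous_latin_trade_def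
    using card_row_puncture[OF punct] card_symbol_puncture[OF punct] n by simp
qed

lemma homogeneous_latin_trade_of_mols:
  assumes pos: "0 < \<mu>" "0 < k"
    and mols: "mutually_orthogonal_latin_squares (k + 1) (\<mu> + 1) L"
  shows "\<exists>T. homogeneous_latin_trade \<mu> k (k + 1) {..<k + 1} T"
proof -
  define n where "n = k + 1"
  have L: "latin_square n (L r)" if "r \<le> \<mu>" for r
    using mols that unfolding mutually_orthogonal_latin_squares_def n_def by simp
  have orth: "orthogonal_squares n (L r) (L r')" if "r \<le> \<mu>" "r' \<le> \<mu>" "r \<noteq> r'" for r r'
    using mols that unfolding mutually_orthogonal_latin_squares_def n_def by simp
  obtain \<sigma> where \<sigma>: "bij_betw \<sigma> {..<n} {..<n}" "\<And>i. i < n \<Longrightarrow> L \<mu> i (\<sigma> i) = 0"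
    using latin_square_symbol_permutation[OF L, of \<mu> 0] n_def by auto
  define f where "f r i = L r i (\<sigma> i)" for r i
  have f: "bij_betw (f r) {..<n} {..<n}" if "r < \<mu>" for r
    unfolding f_def
    by (rule orthogonal_transversal_symbols[OF L orth \<sigma>]) (use that in auto)
  \<comment> \<open>the renaming that turns the entry of \<open>L r\<close> in cell \<open>(i, \<sigma> i)\<close> into \<open>i\<close>\<close>
  define p where "p r = inv_into {..<n} (f r)" for r
  have p: "bij_betw (p r) {..<n} {..<n}" if "r < \<mu>" for r
    unfolding p_def using f[OF that] by (rule bij_betw_inv_into)
  define M where "M r = (\<lambda>i j. p r (L r i j))" for r
  have M: "latin_square n (M r)" if "r < \<mu>" for r
    unfolding M_def using latin_square_relabel[OF L p] that by simp
  have diag: "M r i (\<sigma> i) = i" if "r < \<mu>" "i < n" for r i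
  proof -
    have "p r (f r i) = i"
      unfolding p_def using f[OF \<open>r < \<mu>\<close>] \<open>i < n\<close> by (simp add: bij_betw_inv_into_left)
    then show ?thesis unfolding M_def f_def .
  qed
  have M_orth: "orthogonal_squares n (M r) (M r')" if "r < \<mu>" "r' < \<mu>" "r \<noteq> r'" for r r'
    unfolding M_def using orthogonal_squares_relabel[OF orth p p] that by simp
  have differ: "M r i j \<noteq> M r' i j"
    if "r < \<mu>" "r' < \<mu>" "r \<noteq> r'" "i < n" "j < n" "j \<noteq> \<sigma> i" for r r' i j
    using orthogonal_differ_off_transversal[of n "M r" "M r'" \<sigma> i j] M M_orth \<sigma>(1) diag that
    by simp
  have "homogeneous_latin_trade \<mu> k n {..<n} (\<lambda>r. puncture \<sigma> (M r))"
    by (rule homogeneous_latin_trade_puncture[OF pos n_def])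
      (use M \<sigma>(1) diag differ in blast)+
  then show ?thesis unfolding n_def by blast
qed

section \<open>Attaining the maximum number of orthogonal squares\<close>

lemma mutually_orthogonal_latin_squares_mono:
  assumes "mutually_orthogonal_latin_squares n t L" "t' \<le> t"
  shows "mutually_orthogonal_latin_squares n t' L"
  using assms unfolding mutually_orthogonal_latin_squares_def by auto

text \<open>
  The maximum is attained once the sizes are bounded, and a bound comes from the trade itself:
  \<open>\<mu> + 1\<close> orthogonal squares yield a homogeneous trade of \<open>\<mu>\<close> arrays, which forces \<open>\<mu> \<le> k\<close>.
\<close>

lemma max_mols_attained:
  assumes "0 < k"
  shows "\<exists>L. mutually_orthogonal_latin_squares (k + 1) (max_mols (k + 1)) L"
proof -
  let ?A = "{t. \<exists>L. mutually_orthogonal_latin_squares (k + 1) t L}"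
  have "t \<le> k + 1" if t: "t \<in> ?A" for t
  proof (cases "t \<le> 1")
    case False
    then obtain \<mu> where "t = \<mu> + 1" "0 < \<mu>"
      by (intro that[of "t - 1"]) auto
    with t \<open>0 < k\<close> show ?thesis
      using homogeneous_latin_trade_of_mols[of \<mu> k]
      by (auto simp: homogeneous_latin_trade_def)
  qed simp
  then have "?A \<subseteq> {..k + 1}" by auto
  then have "finite ?A" by (rule finite_subset) simp
  moreover have "0 \<in> ?A"
    by (simp add: mutually_orthogonal_latin_squares_def)
  ultimately have "Max ?A \<in> ?A" by (intro Max_in) auto
  then show ?thesis unfolding max_mols_def by simp
qed

theorem theorem3:
  fixes \<mu> k :: nat
  assumes "0 < \<mu>" and "0 < k"
    and "max_mols (k + 1) \<ge> \<mu> + 1"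
  shows "\<exists>(S :: nat set) T. homogeneous_latin_trade \<mu> k (k + 1) S T"
proof -
  obtain L where "mutually_orthogonal_latin_squares (k + 1) (max_mols (k + 1)) L"
    using max_mols_attained[OF \<open>0 < k\<close>] by blast
  then have "mutually_orthogonal_latin_squares (k + 1) (\<mu> + 1) L"
    using assms(3) by (rule mutually_orthogonal_latin_squares_mono)
  then show ?thesis
    using homogeneous_latin_trade_of_mols[OF assms(1,2)] by blast
qed

end
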